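(* Let $J$ be a finite nonempty set of positive integers, and let $\{x_n\}_{n\ge0}$ be defined by $x_0=1$ and $x_n=\sum_{j\in J,\ j\le n} x_{n-j}$ for $n\ge1$. Then: (i) for every $n\ge1$, $x_n=\mathcal{C}_n^{\{J\}}$; (ii) $\displaystyle\sum_{n\ge1}x_nz^n=\frac{\sum_{j\in J}z^j}{1-\sum_{j\in J}z^j}$; (iii) $\{x_n\}_{n\ge1}$ is the sequence of row sums of the general PI tree with input sequence $g_k=1$ if $k\in J$ and $g_k=0$ otherwise ($k\ge1$).
   Context: $\mathcal{C}_n^{\{J\}}$ denotes the number of tuples $(k_1,\dots,k_m)$, $m\ge1$, with $k_1+\dots+k_m=n$ and every $k_i\in J$ (compositions of $n$ with all parts in $J$). General PI tree: given an input sequence $\{g_n\}_{n\ge1}$, build a binary tree whose nodes are words $g_{i_1}\cdots g_{i_k}$; the root (row 1) is $g_1$, and each node $g_{i_1}g_{i_2}\cdots g_{i_k}$ has the two children $g_1g_{i_1}g_{i_2}\cdots g_{i_k}$ and $g_{i_1+1}g_{i_2}\cdots g_{i_k}$. Row $n$ contains $2^{n-1}$ words, and its row sum is the sum over those words of the products of the numbers $g_i$. *)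

theory Defs
  imports "HOL-Computational_Algebra.Formal_Power_Series"
begin

(* If 0 is not in J, the set below is finite, so card is the true count. *)
definition compositions_count :: "nat set \<Rightarrow> nat \<Rightarrow> nat" where
  "compositions_count J n = card {ks :: nat list. ks \<noteq> [] \<and> set ks \<subseteq> J \<and> sum_list ks = n}"

(* The word g_{i1} ... g_{ik} (k \<ge> 1) is encoded by its list of indices [i1, ..., ik];
   the clause for [] is a dummy, as no node of the tree is the empty word. *)
fun pi_children :: "nat list \<Rightarrow> nat list list" where
  "pi_children [] = []"
| "pi_children (i # w) = [1 # i # w, (i + 1) # w]"

(* Rows are numbered from 1 and are kept as lists, so that words are counted with multiplicity. *)
fun pi_row :: "nat \<Rightarrow> nat list list" where
  "pi_row 0 = []"
| "pi_row (Suc 0) = [[1]]"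
| "pi_row (Suc (Suc n)) = concat (map pi_children (pi_row (Suc n)))"

definition pi_row_sum :: "(nat \<Rightarrow> 'a::semiring_1) \<Rightarrow> nat \<Rightarrow> 'a" where
  "pi_row_sum g n = (\<Sum>w\<leftarrow>pi_row n. prod_list (map g w))"

lemma pi_row_nonempty_words: "w \<in> set (pi_row n) \<Longrightarrow> w \<noteq> []"
proof (induction n arbitrary: w rule: pi_row.induct)
  case (3 n)
  then obtain v where "w \<in> set (pi_children v)" by auto
  then show ?case by (cases v) auto
qed auto

lemma length_pi_row: "length (pi_row (Suc n)) = 2 ^ n"
proof (induction n)
  case (Suc n)
  have "length (pi_children w) = 2" if "w \<in> set (pi_row (Suc n))" for w
    using pi_row_nonempty_words[OF that] by (cases w) auto
  then have "map (length \<circ> pi_children) (pi_row (Suc n)) = map (\<lambda>_. 2) (pi_row (Suc n))"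
    by simp
  then show ?case
    using Suc by (simp add: length_concat sum_list_triv del: map_eq_conv)
qed simp

end

theory Submission
  imports Defs
begin

text \<open>
  Removing the first part of a composition shows that the numbers of compositions satisfy the
  recurrence of \<open>x\<close>, and the same recurrence says \<open>F = 1 + S F\<close> for the generating functions
  \<open>F\<close> of \<open>x\<close> and \<open>S\<close> of \<open>J\<close>. In the PI tree, the two children of a word are the two ways
  of adding 1 to its sum at the front: a new part 1, or a first part increased by 1. The operation
  can be undone uniquely, so row \<open>n\<close> lists every composition of \<open>n\<close> exactly once, and a
  0-1 input sequence selects the compositions with parts in \<open>J\<close>.
\<close>

definition comps :: "nat set \<Rightarrow> nat \<Rightarrow> nat list set" where
  "comps J n = {ks. set ks \<subseteq> J \<and> sum_list ks = n}"

lemma comps_0: "0 \<notin> J \<Longrightarrow> comps J 0 = {[]}"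
proof -
  assume "0 \<notin> J"
  then have "ks = []" if "set ks \<subseteq> J" "sum_list ks = 0" for ks
    using that by (cases ks) auto
  then show ?thesis by (auto simp: comps_def)
qed

lemma comps_rec:
  assumes "1 \<le> n"
  shows "comps J n = (\<Union>j\<in>{j \<in> J. j \<le> n}. (#) j ` comps J (n - j))"
proof (intro set_eqI iffI)
  fix ks assume ks: "ks \<in> comps J n"
  with assms obtain j js where "ks = j # js"
    by (cases ks) (auto simp: comps_def)
  with ks show "ks \<in> (\<Union>j\<in>{j \<in> J. j \<le> n}. (#) j ` comps J (n - j))"
    by (auto simp: comps_def)
qed (auto simp: comps_def)

lemma finite_comps:
  assumes "0 \<notin> J"
  shows "finite (comps J n)"
proof (induction n rule: less_induct)
  case (less n)
  show ?case
  proof (cases "n = 0")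
    case False
    have "finite (comps J (n - j))" if "j \<in> J" for j
      using less.IH[of "n - j"] False that assms by (cases "j = 0") auto
    with False show ?thesis by (subst comps_rec) auto
  qed (simp add: comps_0[OF assms])
qed

text \<open>The sets in the union are disjoint because their lists have different first parts, and
  prefixing a fixed \<open>j\<close> is injective.\<close>

lemma card_comps_rec:
  assumes "0 \<notin> J" "1 \<le> n"
  shows "card (comps J n) = (\<Sum>j\<in>{j \<in> J. j \<le> n}. card (comps J (n - j)))"
proof -
  have "card (comps J n) = (\<Sum>j\<in>{j \<in> J. j \<le> n}. card ((#) j ` comps J (n - j)))"
    unfolding comps_rec[OF assms(2)]
    by (rule card_UN_disjoint) (auto simp: finite_comps[OF assms(1)])
  then show ?thesis by (simp add: card_image)
qed

lemma compositions_count_eq_card_comps: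
  "1 \<le> n \<Longrightarrow> compositions_count J n = card (comps J n)"
  unfolding compositions_count_def comps_def by (rule arg_cong[where f = card]) auto

lemma set_pi_row: "set (pi_row (Suc n)) = comps {1..} (Suc n)"
proof (induction n)
  case 0
  have "w = [1]" if "set w \<subseteq> {1..}" "sum_list w = Suc 0" for w :: "nat list"
  proof (cases w)
    case (Cons a v)
    with that show ?thesis by (cases v) auto
  qed (use that in simp)
  then show ?case by (auto simp: comps_def)
next
  case (Suc n)
  have "w \<in> comps {1..} (Suc (Suc n)) \<longleftrightarrow> (\<exists>v\<in>comps {1..} (Suc n). w \<in> set (pi_children v))" for w
  proof
    assume w: "w \<in> comps {1..} (Suc (Suc n))"
    then obtain a u where wau: "w = a # u" by (cases w) (auto simp: comps_def)
    show "\<exists>v\<in>comps {1..} (Suc n). w \<in> set (pi_children v)"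
    \<comment> \<open>The parent of \<open>w\<close> is found by undoing the growth step: a leading
      1 is dropped, a larger first part is decreased by 1. After a leading 1 the rest is nonempty,
      since the sum of \<open>w\<close> is at least 2.\<close>
    proof (cases "a = 1")
      case True
      with w wau obtain i t where "u = i # t" by (cases u) (auto simp: comps_def)
      with w wau True show ?thesis by (intro bexI[of _ u]) (auto simp: comps_def)
    next
      case False
      with w wau show ?thesis by (intro bexI[of _ "(a - 1) # u"]) (auto simp: comps_def)
    qed
  next
    assume "\<exists>v\<in>comps {1..} (Suc n). w \<in> set (pi_children v)"
    then obtain v where v: "v \<in> comps {1..} (Suc n)" "w \<in> set (pi_children v)" by blast
    then show "w \<in> comps {1..} (Suc (Suc n))"
      by (cases v) (auto simp: comps_def)
  qed
  then show ?case using Suc by auto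
qed

text \<open>With positive entries, a first child starts with 1 and a second child with at least 2,
  so the head of \<open>u\<close> tells how to recover its parent. An entry 0 would break this:
  \<open>1 # w\<close> is also the second child of \<open>0 # w\<close>.\<close>

lemma pi_children_disjoint:
  assumes "0 \<notin> set v" "0 \<notin> set w" "u \<in> set (pi_children v)" "u \<in> set (pi_children w)"
  shows "v = w"
  using assms by (cases v; cases w) auto

lemma distinct_pi_row: "distinct (pi_row (Suc n))"
proof (induction n)
  case (Suc n)
  have pos: "0 \<notin> set w" if "w \<in> set (pi_row (Suc n))" for w
    using that unfolding set_pi_row by (auto simp: comps_def)
  have children: "pi_children w \<noteq> [] \<and> distinct (pi_children w)"
    if "w \<in> set (pi_row (Suc n))" for w
    using pi_row_nonempty_words[OF that] by (cases w) auto
  \<comment> \<open>Equal lists of children are nonempty, hence share an element, which forces equal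
    parents.\<close>
  have "inj_on pi_children (set (pi_row (Suc n)))"
    by (metis (no_types, lifting) children inj_onI list.set_sel(1) pi_children_disjoint pos)
  then have "distinct (concat (map pi_children (pi_row (Suc n))))"
    using Suc children pi_children_disjoint pos
    by (intro distinct_concat) (auto simp: distinct_map, blast)
  then show ?case by simp
qed simp

lemma prod_list_indicator:
  "prod_list (map (\<lambda>k. if k \<in> J then 1 else 0) w) = (if set w \<subseteq> J then 1 else (0::'a::semiring_1))"
  by (induction w) auto

text \<open>As row \<open>n\<close> lists each composition of \<open>n\<close> once, its sum is a
  sum over the set \<open>comps {1..} n\<close>, where exactly the words with all parts in
  \<open>J\<close> contribute 1.\<close>

lemma pi_row_sum_indicator:
  assumes "0 \<notin> J" "1 \<le> n"
  shows "pi_row_sum (\<lambda>k. if k \<in> J then 1 else 0) n = (of_nat (card (comps J n)) :: 'a::semiring_1)"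
proof -
  obtain m where n: "n = Suc m" using assms(2) by (cases n) auto
  have fin: "finite (comps {1..} n)" by (rule finite_comps) simp
  have "J \<subseteq> {1..}" using assms(1) by (metis atLeast_iff less_one not_less subsetI)
  then have "comps {1..} n \<inter> {w. set w \<subseteq> J} = comps J n" by (auto simp: comps_def)
  moreover have "pi_row_sum (\<lambda>k. if k \<in> J then 1 else 0) n
      = (\<Sum>w\<in>comps {1..} n. if set w \<subseteq> J then 1 else (0::'a))"
    unfolding pi_row_sum_def prod_list_indicator n
    by (simp only: sum_list_distinct_conv_sum_set[OF distinct_pi_row] set_pi_row)
  ultimately show ?thesis
    by (simp only: sum.If_cases[OF fin]) simp
qed

lemma fps_linear_recurrence:
  fixes x :: "nat \<Rightarrow> 'a::field"
  assumes "finite J" "0 \<notin> J" "x 0 = 1"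
    and rec: "\<And>n. 1 \<le> n \<Longrightarrow> x n = (\<Sum>j\<in>{j \<in> J. j \<le> n}. x (n - j))"
  shows "Abs_fps (\<lambda>n. if 1 \<le> n then x n else 0)
    = (\<Sum>j\<in>J. fps_X ^ j) / (1 - (\<Sum>j\<in>J. fps_X ^ j))"
proof -
  define S :: "'a fps" where "S = (\<Sum>j\<in>J. fps_X ^ j)"
  define F where "F = Abs_fps x"
  have S0: "fps_nth S 0 = 0"
    using assms(2) by (auto simp: S_def fps_sum_nth intro!: sum.neutral gr0I)
  \<comment> \<open>The constant term is \<open>x 0 = 1\<close>, as \<open>S\<close> has none; the
    higher coefficients are the recurrence.\<close>
  have FS: "F = 1 + S * F"
  proof (rule fps_ext)
    fix n
    show "fps_nth F n = fps_nth (1 + S * F) n"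
    proof (cases "n = 0")
      case True
      then show ?thesis using S0 assms(3) by (simp add: F_def)
    next
      case False
      have "fps_nth (S * F) n = (\<Sum>j\<in>J. if n < j then 0 else x (n - j))"
        by (simp add: S_def F_def sum_distrib_right fps_sum_nth fps_X_power_mult_nth cong: if_cong)
      also have "\<dots> = (\<Sum>j\<in>{j \<in> J. j \<le> n}. x (n - j))"
        using assms(1) by (intro sum.mono_neutral_cong_right) auto
      finally show ?thesis using False rec[of n] by (simp add: F_def)
    qed
  qed
  have "(F - 1) * (1 - S) = S"
    using FS by algebra
  moreover have "Abs_fps (\<lambda>n. if 1 \<le> n then x n else 0) = F - 1"
    by (rule fps_ext) (use assms(3) in \<open>auto simp: F_def not_less_eq_eq\<close>)
  ultimately have "Abs_fps (\<lambda>n. if 1 \<le> n then x n else 0) * (1 - S) = S"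
    by simp
  \<comment> \<open>Its constant coefficient is 1.\<close>
  moreover have "1 - S \<noteq> 0"
    using S0 by (metis diff_zero fps_one_nth fps_sub_nth fps_zero_nth zero_neq_one)
  ultimately show ?thesis
    unfolding S_def by (metis nonzero_mult_div_cancel_right)
qed

theorem theorem16:
  fixes J :: "nat set" and x :: "nat \<Rightarrow> nat"
  assumes "finite J" and "J \<noteq> {}" and "\<And>j. j \<in> J \<Longrightarrow> 1 \<le> j"
    and "x 0 = 1"
    and "\<And>n. 1 \<le> n \<Longrightarrow> x n = (\<Sum>j\<in>{j \<in> J. j \<le> n}. x (n - j))"
  shows "(\<forall>n\<ge>1. x n = compositions_count J n)
    \<and> Abs_fps (\<lambda>n. if 1 \<le> n then (of_nat (x n) :: rat) else 0)
        = (\<Sum>j\<in>J. fps_X ^ j) / (1 - (\<Sum>j\<in>J. fps_X ^ j))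
    \<and> (\<forall>n\<ge>1. x n = pi_row_sum (\<lambda>k. if k \<in> J then 1 else 0) n)"
proof -
  have J0: "0 \<notin> J" using assms(3) by force
  \<comment> \<open>Both sides have the same initial value and recurrence; claims (i) and (iii) both
    reduce to this identity.\<close>
  have x: "x n = card (comps J n)" for n
  proof (induction n rule: less_induct)
    case (less n)
    show ?case
    proof (cases "n = 0")
      case False
      then have "x (n - j) = card (comps J (n - j))" if "j \<in> J" for j
        using less.IH assms(3)[OF that] by simp
      with False show ?thesis by (simp add: assms(5) card_comps_rec[OF J0])
    qed (simp add: comps_0[OF J0] assms(4))
  qed
  have "Abs_fps (\<lambda>n. if 1 \<le> n then (of_nat (x n) :: rat) else 0)
        = (\<Sum>j\<in>J. fps_X ^ j) / (1 - (\<Sum>j\<in>J. fps_X ^ j))"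
  proof (rule fps_linear_recurrence[OF assms(1) J0])
    fix n :: nat assume "1 \<le> n"
    then show "(of_nat (x n) :: rat) = (\<Sum>j\<in>{j \<in> J. j \<le> n}. of_nat (x (n - j)))"
      by (subst assms(5)) simp_all
  qed (simp add: assms(4))
  then show ?thesis
    by (simp add: x compositions_count_eq_card_comps pi_row_sum_indicator[OF J0])
qed

end
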